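(* Let $M$ be an $n$-dimensional smooth manifold, $E\in\Gamma(T^*M\otimes T^*M)$, and let $\rho_a\in\Gamma(TM)$ ($a=1,\dots,k$) be involutive vector fields defining a Lie algebroid $[\rho_a,\rho_b]=C^c{}_{ab}\rho_c$. The generalised Killing equation $$(\mathcal{L}_{\rho_a}E)_{\mu\nu}=E_{\mu\lambda}\rho^\lambda_b(\Omega^+)^b{}_{\nu a}+E_{\lambda\nu}\rho^\lambda_b(\Omega^-)^b{}_{\mu a}\qquad (a=1,\dots,k)$$ has solutions for $\Omega^\pm_a\in\Gamma(T^*M\otimes Q)$ if and only if $$\mathcal{L}_{\rho_a}E-(E^T\rho\,\Omega^-_a)^T=E\rho(E\rho)^+\big(\mathcal{L}_{\rho_a}E-(E^T\rho\,\Omega^-_a)^T\big)\qquad (a=1,\dots,k)$$ holds for some set $\{\Omega^-_a\}$. If there exists a set $\{\rho_a,\Omega^-_a\}$ satisfying this condition, then solutions are given by $$\Omega^+_a=(E\rho)^+\big(\mathcal{L}_{\rho_a}E-(E^T\rho\,\Omega^-_a)^T\big)+\big(I-(E\rho)^+E\rho\big)X_a,$$ where $X_a\in C^\infty(M,\mathbb{R}^{k\times n})$ is arbitrary and $I$ is the $k\times k$ identity matrix. In addition, any solution $\Omega^+_a$ is of this form.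
   Context: All formulas are written in local coordinates $x^\mu$, $\mu,\nu,\lambda=1,\dots,n$, with the summation convention; $a,b,c=1,\dots,k$. Write $\rho_a=\rho^\mu_a\partial_\mu$; $\rho$ denotes the $n\times k$ matrix with entries $\rho^\mu_a$, and $E$ the $n\times n$ matrix $(E_{\mu\nu})$. $\mathcal{L}$ is the Lie derivative, and $\mathcal{L}_{\rho_a}E$ is regarded as the $n\times n$ matrix $((\mathcal{L}_{\rho_a}E)_{\mu\nu})$. Involutive means $[\rho_a,\rho_b]=C^c{}_{ab}\rho_c$ with $C^c{}_{ab}\in C^\infty(M)$. The $\rho_a$ are not assumed linearly independent. $Q\to M$ is a rank-$k$ vector bundle with local frame $\{e_a\}$, with Lie algebroid structure $[e_a,e_b]_Q=C^c{}_{ab}e_c$ and anchor $\rho(e_a)=\rho_a$. For each $a$, $\Omega^\pm_a$ denotes the $k\times n$ matrix with entries $(\Omega^\pm_a)^b{}_\mu=(\Omega^\pm)^b{}_{\mu a}$; these are the connection coefficients of $TM$-connections $\nabla^\pm$ on $Q$, $\nabla^\pm e_a=(\Omega^\pm)^b{}_a\otimes e_b$. $E\rho$ is the $n\times k$ matrix product, and $(E\rho)^+$ is its Moore--Penrose pseudo-inverse (a $k\times n$ matrix, taken pointwise). The entries of $(E^T\rho\,\Omega^-_a)^T$ are $\big((E^T\rho\,\Omega^-_a)^T\big)_{\mu\nu}=E_{\lambda\nu}\rho^\lambda_b(\Omega^-)^b{}_{\mu a}$.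
   Formalization: Existence of smooth solutions and smoothness of the formula assume (Eρ)^+ is smooth (rank Eρ locally constant), else false: ρ=d/dx, E=exp(-1/x²). Otherwise the equivalence allows non-smooth Ω^+. The formula and X_a are stated in each coordinate chart. *)

theory Defs
  imports "HOL-Analysis.Analysis"
begin

section \<open>Smooth maps between open subsets of normed spaces\<close>

primrec Ck_on :: "nat \<Rightarrow> 'a::real_normed_vector set \<Rightarrow> ('a \<Rightarrow> 'b::real_normed_vector) \<Rightarrow> bool" where
  "Ck_on 0 S f \<longleftrightarrow> continuous_on S f"
| "Ck_on (Suc k) S f \<longleftrightarrow>
     (\<forall>x\<in>S. f differentiable (at x)) \<and> (\<forall>v. Ck_on k S (\<lambda>x. frechet_derivative f (at x) v))"

text \<open>Used for open \<open>S\<close> only; all derivatives are full derivatives \<open>at x\<close>.\<close>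

definition smooth_on :: "'a::real_normed_vector set \<Rightarrow> ('a \<Rightarrow> 'b::real_normed_vector) \<Rightarrow> bool" where
  "smooth_on S f \<longleftrightarrow> (\<forall>k. Ck_on k S f)"

definition pderiv_at :: "'n \<Rightarrow> (real^'n \<Rightarrow> real) \<Rightarrow> real^'n \<Rightarrow> real" where
  "pderiv_at \<mu> f x = frechet_derivative f (at x) (axis \<mu> 1)"


section \<open>Smooth manifolds\<close>

text \<open>
  A manifold is a whole Hausdorff second countable type \<open>'m\<close> with a smooth atlas; its dimension
  is \<open>CARD('n)\<close>. A chart is a pair of a domain and a coordinate map, whose values outside the
  domain are irrelevant.
\<close>

type_synonym ('m, 'n) chart = "'m set \<times> ('m \<Rightarrow> real^'n)"

definition coords :: "('m, 'n) chart \<Rightarrow> (real^'n) set" where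
  "coords c = snd c ` fst c"

definition chart_inv :: "('m, 'n) chart \<Rightarrow> real^'n \<Rightarrow> 'm" where
  "chart_inv c = inv_into (fst c) (snd c)"

definition overlap :: "('m, 'n) chart \<Rightarrow> ('m, 'n) chart \<Rightarrow> (real^'n) set" where
  "overlap c d = snd c ` (fst c \<inter> fst d)"

definition transition :: "('m, 'n) chart \<Rightarrow> ('m, 'n) chart \<Rightarrow> real^'n \<Rightarrow> real^'n" where
  "transition c d = snd d \<circ> chart_inv c"

definition smooth_atlas ::
    "('m::{t2_space,second_countable_topology}, 'n::finite) chart set \<Rightarrow> bool" where
  "smooth_atlas A \<longleftrightarrow>
     (\<Union>c\<in>A. fst c) = UNIV \<and>
     (\<forall>c\<in>A. open (fst c) \<and> open (coords c) \<and>
            homeomorphism (fst c) (coords c) (snd c) (chart_inv c)) \<and>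
     (\<forall>c\<in>A. \<forall>d\<in>A. smooth_on (overlap c d) (transition c d))"

definition smooth_fun :: "('m, 'n::finite) chart set \<Rightarrow> ('m \<Rightarrow> 'b::real_normed_vector) \<Rightarrow> bool" where
  "smooth_fun A f \<longleftrightarrow> (\<forall>c\<in>A. smooth_on (coords c) (f \<circ> chart_inv c))"


section \<open>Tensor fields\<close>

text \<open>
  A field assigns to every chart its components as functions of the coordinates \<open>x\<close> of that
  chart. The components in two charts \<open>c\<close> (coordinates \<open>x\<close>) and \<open>d\<close> (coordinates \<open>y\<close>) are related
  by the usual tensor transformation law, in terms of the Jacobian matrix with entries
  \<open>\<partial>y\<^sup>\<alpha> / \<partial>x\<^sup>\<mu>\<close> (row \<open>\<alpha>\<close>, column \<open>\<mu>\<close>).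
\<close>

type_synonym ('m, 'n, 'v) field = "('m, 'n) chart \<Rightarrow> real^'n \<Rightarrow> 'v"

definition jac :: "('m, 'n::finite) chart \<Rightarrow> ('m, 'n) chart \<Rightarrow> real^'n \<Rightarrow> real^'n^'n" where
  "jac c d x = jacobian (transition c d) (at x)"

definition smooth_field ::
    "('m, 'n::finite) chart set \<Rightarrow> ('m, 'n, 'v::real_normed_vector) field \<Rightarrow> bool" where
  "smooth_field A F \<longleftrightarrow> (\<forall>c\<in>A. smooth_on (coords c) (F c))"

text \<open>\<open>\<Gamma>(TM)\<close>\<close>

definition vector_field ::
    "('m, 'n::finite) chart set \<Rightarrow> ('m, 'n, real^'n) field \<Rightarrow> bool" where
  "vector_field A v \<longleftrightarrow> smooth_field A v \<and>
     (\<forall>c\<in>A. \<forall>d\<in>A. \<forall>x\<in>overlap c d. v d (transition c d x) = jac c d x *v v c x)"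

text \<open>\<open>\<Gamma>(T\<^sup>*M \<otimes> T\<^sup>*M)\<close>; no symmetry is imposed\<close>

definition cov2_tensor_field ::
    "('m, 'n::finite) chart set \<Rightarrow> ('m, 'n, real^'n^'n) field \<Rightarrow> bool" where
  "cov2_tensor_field A E \<longleftrightarrow> smooth_field A E \<and>
     (\<forall>c\<in>A. \<forall>d\<in>A. \<forall>x\<in>overlap c d.
        E c x = transpose (jac c d x) ** E d (transition c d x) ** jac c d x)"

text \<open>
  \<open>Q\<close> is framed by \<open>(e\<^sub>a)\<close>, \<open>a :: 'k\<close>, so that a section of \<open>Q\<close> is a map \<open>'m \<Rightarrow> real^'k\<close>, and a section
  \<open>\<omega>\<^sup>b\<^sub>\<mu> dx\<^sup>\<mu> \<otimes> e\<^sub>b\<close> of \<open>T\<^sup>*M \<otimes> Q\<close> is given in each chart by the \<open>k \<times> n\<close> matrix with entries \<open>\<omega>\<^sup>b\<^sub>\<mu>\<close>.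
  The first predicate does not ask for any regularity.
\<close>

definition TQ_section ::
    "('m, 'n::finite) chart set \<Rightarrow> ('m, 'n, real^'n^'k) field \<Rightarrow> bool" where
  "TQ_section A \<omega> \<longleftrightarrow>
     (\<forall>c\<in>A. \<forall>d\<in>A. \<forall>x\<in>overlap c d. \<omega> c x = \<omega> d (transition c d x) ** jac c d x)"

definition smooth_TQ_section ::
    "('m, 'n::finite) chart set \<Rightarrow> ('m, 'n, real^'n^'k::finite) field \<Rightarrow> bool" where
  "smooth_TQ_section A \<omega> \<longleftrightarrow> TQ_section A \<omega> \<and> smooth_field A \<omega>"

definition lie_bracket ::
    "(real^'n \<Rightarrow> real^'n) \<Rightarrow> (real^'n \<Rightarrow> real^'n) \<Rightarrow> real^'n \<Rightarrow> real^'n::finite" where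
  "lie_bracket u v x = (\<chi> \<mu>. \<Sum>\<nu>\<in>UNIV.
     u x $ \<nu> * pderiv_at \<nu> (\<lambda>y. v y $ \<mu>) x - v x $ \<nu> * pderiv_at \<nu> (\<lambda>y. u y $ \<mu>) x)"

definition lie_deriv ::
    "(real^'n \<Rightarrow> real^'n) \<Rightarrow> (real^'n \<Rightarrow> real^'n^'n) \<Rightarrow> real^'n \<Rightarrow> real^'n^'n::finite" where
  "lie_deriv v E x = (\<chi> \<mu> \<nu>. \<Sum>\<kappa>\<in>UNIV.
       v x $ \<kappa> * pderiv_at \<kappa> (\<lambda>y. E y $ \<mu> $ \<nu>) x
     + E x $ \<kappa> $ \<nu> * pderiv_at \<mu> (\<lambda>y. v y $ \<kappa>) x
     + E x $ \<mu> $ \<kappa> * pderiv_at \<nu> (\<lambda>y. v y $ \<kappa>) x)"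


section \<open>Lie algebroids on a framed bundle\<close>

text \<open>\<open>C c a b\<close> is the structure function \<open>C\<^sup>c\<^sub>a\<^sub>b\<close>.\<close>

definition involutive_with ::
    "('m, 'n::finite) chart set \<Rightarrow> ('k::finite \<Rightarrow> ('m, 'n, real^'n) field) \<Rightarrow>
     ('k \<Rightarrow> 'k \<Rightarrow> 'k \<Rightarrow> 'm \<Rightarrow> real) \<Rightarrow> bool" where
  "involutive_with A \<rho> C \<longleftrightarrow>
     (\<forall>c a b. smooth_fun A (C c a b)) \<and>
     (\<forall>a b. \<forall>i\<in>A. \<forall>x\<in>coords i.
        lie_bracket (\<rho> a i) (\<rho> b i) x = (\<Sum>c\<in>UNIV. C c a b (chart_inv i x) *\<^sub>R \<rho> c i x))"

text \<open>The derivative at \<open>p\<close> of \<open>f\<close> along \<open>\<rho>(s) = s\<^sup>a \<rho>\<^sub>a\<close>, computed in the chart \<open>i\<close>.\<close>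

definition anchor_deriv ::
    "('k::finite \<Rightarrow> ('m, 'n::finite, real^'n) field) \<Rightarrow> ('m, 'n) chart \<Rightarrow>
     ('m \<Rightarrow> real^'k) \<Rightarrow> ('m \<Rightarrow> real) \<Rightarrow> 'm \<Rightarrow> real" where
  "anchor_deriv \<rho> i s f p = (\<Sum>a\<in>UNIV. \<Sum>\<mu>\<in>UNIV.
     s p $ a * \<rho> a i (snd i p) $ \<mu> * pderiv_at \<mu> (f \<circ> chart_inv i) (snd i p))"

definition lie_algebroid ::
    "('m, 'n::finite) chart set \<Rightarrow> ('k::finite \<Rightarrow> ('m, 'n, real^'n) field) \<Rightarrow>
     (('m \<Rightarrow> real^'k) \<Rightarrow> ('m \<Rightarrow> real^'k) \<Rightarrow> ('m \<Rightarrow> real^'k)) \<Rightarrow> bool" where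
  "lie_algebroid A \<rho> br \<longleftrightarrow>
     (\<forall>s t. smooth_fun A s \<and> smooth_fun A t \<longrightarrow>
        smooth_fun A (br s t) \<and>
        br s t = (\<lambda>p. - br t s p) \<and>
        (\<forall>r. br s (\<lambda>p. r *\<^sub>R t p) = (\<lambda>p. r *\<^sub>R br s t p)) \<and>
        (\<forall>f. smooth_fun A f \<longrightarrow> (\<forall>i\<in>A. \<forall>p\<in>fst i.
           br s (\<lambda>q. f q *\<^sub>R t q) p = f p *\<^sub>R br s t p + anchor_deriv \<rho> i s f p *\<^sub>R t p))) \<and>
     (\<forall>s t u. smooth_fun A s \<and> smooth_fun A t \<and> smooth_fun A u \<longrightarrow>
        br s (\<lambda>p. t p + u p) = (\<lambda>p. br s t p + br s u p) \<and>
        (\<forall>p. br s (br t u) p + br t (br u s) p + br u (br s t) p = 0))"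

definition frame :: "'k::finite \<Rightarrow> 'm \<Rightarrow> real^'k" where
  "frame a = (\<lambda>p. axis a 1)"


section \<open>The generalised Killing equation in a coordinate chart\<close>

text \<open>An \<open>n \<times> k\<close> matrix has type \<open>real^'k^'n\<close>.\<close>

definition is_pinv :: "real^'k^'n \<Rightarrow> real^'n^'k \<Rightarrow> bool" where
  "is_pinv A B \<longleftrightarrow> A ** B ** A = A \<and> B ** A ** B = B \<and>
     transpose (A ** B) = A ** B \<and> transpose (B ** A) = B ** A"

definition pinv :: "real^'k::finite^'n::finite \<Rightarrow> real^'n^'k" where
  "pinv A = (THE B. is_pinv A B)"

definition rho_mat :: "('k \<Rightarrow> real^'n \<Rightarrow> real^'n) \<Rightarrow> real^'n \<Rightarrow> real^'k::finite^'n::finite" where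
  "rho_mat \<rho> x = (\<chi> \<mu> a. \<rho> a x $ \<mu>)"

definition gen_killing_on ::
    "(real^'n) set \<Rightarrow> (real^'n \<Rightarrow> real^'n^'n) \<Rightarrow> ('k \<Rightarrow> real^'n \<Rightarrow> real^'n) \<Rightarrow>
     ('k \<Rightarrow> real^'n \<Rightarrow> real^'n^'k) \<Rightarrow> ('k \<Rightarrow> real^'n \<Rightarrow> real^'n::finite^'k::finite) \<Rightarrow> bool" where
  "gen_killing_on S E \<rho> \<Omega>p \<Omega>m \<longleftrightarrow> (\<forall>a. \<forall>x\<in>S. \<forall>\<mu> \<nu>.
     lie_deriv (\<rho> a) E x $ \<mu> $ \<nu> =
       (\<Sum>\<kappa>\<in>UNIV. \<Sum>b\<in>UNIV. E x $ \<mu> $ \<kappa> * \<rho> b x $ \<kappa> * \<Omega>p a x $ b $ \<nu>)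
     + (\<Sum>\<kappa>\<in>UNIV. \<Sum>b\<in>UNIV. E x $ \<kappa> $ \<nu> * \<rho> b x $ \<kappa> * \<Omega>m a x $ b $ \<mu>))"

text \<open>\<open>\<L>\<^bsub>\<rho>\<^sub>a\<^esub> E - (E\<^sup>T \<rho> \<Omega>\<^sup>-\<^sub>a)\<^sup>T\<close>\<close>

definition killing_rhs ::
    "(real^'n \<Rightarrow> real^'n^'n) \<Rightarrow> ('k \<Rightarrow> real^'n \<Rightarrow> real^'n) \<Rightarrow>
     ('k \<Rightarrow> real^'n \<Rightarrow> real^'n^'k::finite) \<Rightarrow> 'k \<Rightarrow> real^'n \<Rightarrow> real^'n::finite^'n" where
  "killing_rhs E \<rho> \<Omega>m a x =
     lie_deriv (\<rho> a) E x - transpose (transpose (E x) ** rho_mat \<rho> x ** \<Omega>m a x)"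

definition solvability_on ::
    "(real^'n) set \<Rightarrow> (real^'n \<Rightarrow> real^'n^'n) \<Rightarrow> ('k \<Rightarrow> real^'n \<Rightarrow> real^'n) \<Rightarrow>
     ('k \<Rightarrow> real^'n \<Rightarrow> real^'n::finite^'k::finite) \<Rightarrow> bool" where
  "solvability_on S E \<rho> \<Omega>m \<longleftrightarrow> (\<forall>a. \<forall>x\<in>S.
     killing_rhs E \<rho> \<Omega>m a x =
       E x ** rho_mat \<rho> x ** pinv (E x ** rho_mat \<rho> x) ** killing_rhs E \<rho> \<Omega>m a x)"

definition solution_formula ::
    "(real^'n \<Rightarrow> real^'n^'n) \<Rightarrow> ('k \<Rightarrow> real^'n \<Rightarrow> real^'n) \<Rightarrow> ('k \<Rightarrow> real^'n \<Rightarrow> real^'n^'k) \<Rightarrow>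
     ('k \<Rightarrow> real^'n \<Rightarrow> real^'n^'k) \<Rightarrow> 'k \<Rightarrow> real^'n \<Rightarrow> real^'n::finite^'k::finite" where
  "solution_formula E \<rho> \<Omega>m X a x =
     pinv (E x ** rho_mat \<rho> x) ** killing_rhs E \<rho> \<Omega>m a x
     + (mat 1 - pinv (E x ** rho_mat \<rho> x) ** (E x ** rho_mat \<rho> x)) ** X a x"


section \<open>Global versions\<close>

text \<open>\<open>in_chart F c\<close> lists the components in the chart \<open>c\<close> of a family of fields.\<close>

definition in_chart :: "('k \<Rightarrow> ('m, 'n, 'v) field) \<Rightarrow> ('m, 'n) chart \<Rightarrow> 'k \<Rightarrow> real^'n \<Rightarrow> 'v" where
  "in_chart F c = (\<lambda>a. F a c)"

definition gen_killing ::
    "('m, 'n::finite) chart set \<Rightarrow> ('m, 'n, real^'n^'n) field \<Rightarrow>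
     ('k::finite \<Rightarrow> ('m, 'n, real^'n) field) \<Rightarrow> ('k \<Rightarrow> ('m, 'n, real^'n^'k) field) \<Rightarrow>
     ('k \<Rightarrow> ('m, 'n, real^'n^'k) field) \<Rightarrow> bool" where
  "gen_killing A E \<rho> \<Omega>p \<Omega>m \<longleftrightarrow> (\<forall>c\<in>A.
     gen_killing_on (coords c) (E c) (in_chart \<rho> c) (in_chart \<Omega>p c) (in_chart \<Omega>m c))"

definition solvability ::
    "('m, 'n::finite) chart set \<Rightarrow> ('m, 'n, real^'n^'n) field \<Rightarrow>
     ('k::finite \<Rightarrow> ('m, 'n, real^'n) field) \<Rightarrow> ('k \<Rightarrow> ('m, 'n, real^'n^'k) field) \<Rightarrow> bool" where
  "solvability A E \<rho> \<Omega>m \<longleftrightarrow> (\<forall>c\<in>A.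
     solvability_on (coords c) (E c) (in_chart \<rho> c) (in_chart \<Omega>m c))"

text \<open>
  Moore--Penrose inversion is not continuous where the rank jumps, so \<open>(E\<rho>)\<^sup>+\<close>, taken pointwise,
  is smooth exactly if the rank of \<open>E\<rho>\<close> is locally constant. Without this, the solution formula
  need not define a smooth field: on the real line, \<open>E = exp (- 1 / x\<^sup>2)\<close>, \<open>\<rho> = \<partial>\<^sub>x\<close> satisfy the
  solvability condition with \<open>\<Omega>\<^sup>- = 0\<close>, but \<open>\<Omega>\<^sup>+ + \<Omega>\<^sup>- = 2 / x\<^sup>3\<close> for every solution.
\<close>

definition smooth_pinv ::
    "('m, 'n::finite) chart set \<Rightarrow> ('m, 'n, real^'n^'n) field \<Rightarrow>
     ('k::finite \<Rightarrow> ('m, 'n, real^'n) field) \<Rightarrow> bool" where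
  "smooth_pinv A E \<rho> \<longleftrightarrow>
     (\<forall>c\<in>A. smooth_on (coords c) (\<lambda>x. pinv (E c x ** rho_mat (in_chart \<rho> c) x)))"

end

theory Submission
  imports Defs
begin

text \<open>
  At each point and for each \<open>a\<close>, the generalised Killing equation is a linear matrix equation
  \<open>B \<Omega> = F\<close> for \<open>\<Omega> = \<Omega>\<^sup>+\<^sub>a\<close>, where \<open>B = E\<rho>\<close> and \<open>F = \<L>\<^bsub>\<rho>\<^sub>a\<^esub> E - (E\<^sup>T \<rho> \<Omega>\<^sup>-\<^sub>a)\<^sup>T\<close>
  (\<open>gen_killing_on_iff\<close>). As \<open>B B\<^sup>+ B = B\<close>, such an equation is solvable if and only if \<open>F = B B\<^sup>+ F\<close>, and then
  its solutions are the matrices \<open>B\<^sup>+ F + (1 - B\<^sup>+ B) X\<close>: every such matrix is a solution, and a solution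
  \<open>\<Omega>\<close> is obtained for \<open>X = \<Omega>\<close>. This proves everything that can be said in a single chart; if \<open>B\<^sup>+\<close> and \<open>X\<close>
  are smooth, the formula is built from smooth maps by sums, matrix products and derivatives.

  Solvability by a section of \<open>T\<^sup>*M \<otimes> Q\<close> is a global matter. In each chart there is the solution \<open>B\<^sup>+ F\<close>,
  and these have to transform as a section. The Moore--Penrose inverse itself is not covariant: a change
  of charts with Jacobian matrix \<open>J\<close> replaces \<open>B\<close> by \<open>J\<^sup>T B\<close>, and \<open>(J\<^sup>T B)\<^sup>+\<close> is in general not
  \<open>B\<^sup>+ (J\<^sup>T)\<^sup>-\<^sup>1\<close>. However, \<open>B\<^sup>+ F\<close> is the solution whose columns are orthogonal to the kernel of \<open>B\<close>. The
  kernel does not change, and orthogonality refers to the inner product on the fibres of \<open>Q\<close> in which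
  the given frame is orthonormal, hence not to the chart (\<open>pinv_solution_covariant\<close>).

  It remains to know that \<open>F\<close> is a tensor, that is, that the Lie derivative commutes with changes of
  coordinates (\<open>lie_deriv_pullback\<close>). The second derivatives of the transition map cancel by their
  symmetry (\<open>second_derivative_symmetric\<close>).
\<close>

section \<open>The Moore--Penrose inverse of a real matrix\<close>

lemma bounded_bilinear_matrix_mul:
  "bounded_bilinear ((**) :: real^'k^'n \<Rightarrow> real^'m^'k \<Rightarrow> real^'m^'n)"
  by (rule bilinear_conv_bounded_bilinear[THEN iffD1])
    (auto simp: bilinear_def matrix_matrix_mult_def vec_eq_iff sum.distrib sum_distrib_left
      algebra_simps intro!: linearI)

lemma bounded_linear_transpose: "bounded_linear (transpose :: real^'k^'n \<Rightarrow> real^'n^'k)"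
  by (rule linear_conv_bounded_linear[THEN iffD1])
    (auto intro!: linearI simp: transpose_def vec_eq_iff)

lemmas matrix_mul_diff_left = bounded_bilinear.diff_left[OF bounded_bilinear_matrix_mul]
lemmas matrix_mul_diff_right = bounded_bilinear.diff_right[OF bounded_bilinear_matrix_mul]

text \<open>
  Column by column this is least squares: for any \<open>y\<close> the orthogonal projection of \<open>y\<close> to the range
  of \<open>A\<close> is some \<open>A v\<close>, and \<open>y - A v\<close> is killed by \<open>A\<^sup>T\<close>.
\<close>

lemma normal_equations_solvable:
  fixes A :: "real^'k^'n"
  obtains X where "transpose A ** A ** X = transpose A"
proof -
  have col: "\<exists>v. transpose A *v (A *v v) = transpose A *v y" for y
  proof -
    obtain p q where p: "p \<in> span (range ((*v) A))"
      and q: "\<And>w. w \<in> span (range ((*v) A)) \<Longrightarrow> orthogonal q w" and y: "y = p + q"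
      using orthogonal_subspace_decomp_exists[of "range ((*v) A)" y] by metis
    have "subspace (range ((*v) A))"
      by (intro linear_subspace_image matrix_vector_mul_linear subspace_UNIV)
    then obtain v where v: "p = A *v v"
      using p by (metis imageE span_eq_iff)
    have "transpose A *v q = 0"
    proof (rule vector_eq_rdot[THEN iffD1], rule allI)
      fix w
      have "q \<bullet> (A *v w) = 0"
        using q[of "A *v w"] by (auto simp: orthogonal_def span_base)
      then show "(transpose A *v q) \<bullet> w = 0 \<bullet> w"
        by (simp add: dot_lmul_matrix)
    qed
    then have "transpose A *v (A *v v) = transpose A *v y"
      unfolding y v by (simp only: matrix_vector_right_distrib add_0_right)
    then show ?thesis by blast
  qed
  then obtain v where v: "\<And>y. transpose A *v (A *v v y) = transpose A *v y"
    by metis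
  \<comment> \<open>the columns of \<open>X\<close> are the least squares solutions for the standard basis vectors\<close>
  define X where "X = transpose (\<chi> j. v (axis j 1))"
  have X: "X *v axis j 1 = v (axis j 1)" for j
    unfolding X_def matrix_vector_mul_component vec_eq_iff matrix_vector_mult_basis column_def
      transpose_def by simp
  have "transpose A ** A ** X = transpose A"
  proof -
    have "column j (transpose A ** A ** X) = column j (transpose A)" for j
      using v[of "axis j 1"]
      by (simp only: matrix_vector_mult_basis[symmetric] matrix_vector_mul_assoc[symmetric] X)
    then show ?thesis
      by (auto simp: column_def vec_eq_iff)
  qed
  then show thesis by (rule that)
qed

text \<open>
  Solving the normal equations of \<open>A\<close> and of \<open>A\<^sup>T\<close> gives two one-sided versions of the inverse:
  \<open>A X A = A\<close> with \<open>A X\<close> symmetric, and \<open>A Z A = A\<close> with \<open>Z A\<close> symmetric. Then \<open>Z A X\<close> satisfies all four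
  Penrose conditions, because \<open>A (Z A X) = A X\<close> and \<open>(Z A X) A = Z A\<close>.
\<close>

lemma is_pinv_exists:
  fixes A :: "real^'k^'n"
  obtains B where "is_pinv A B"
proof -
  obtain X where X: "transpose A ** A ** X = transpose A"
    using normal_equations_solvable by blast
  obtain Y where Y: "transpose (transpose A) ** transpose A ** Y = transpose (transpose A)"
    using normal_equations_solvable[of "transpose A"] by blast
  define Z where "Z = transpose Y"
  have Xt: "transpose X ** transpose A ** A = A"
    using arg_cong[OF X, of transpose] by (simp add: matrix_transpose_mul matrix_mul_assoc)
  have "transpose (A ** X) = transpose X ** transpose A ** A ** X"
    by (metis X matrix_mul_assoc matrix_transpose_mul)
  then have AX: "transpose (A ** X) = A ** X"
    by (simp add: Xt)
  have AXA: "A ** X ** A = A"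
    by (metis AX Xt matrix_transpose_mul)
  have Z: "Z ** A ** transpose A = transpose A"
    using arg_cong[OF Y, of transpose] by (simp add: matrix_transpose_mul matrix_mul_assoc Z_def)
  have "transpose (Z ** A) = Z ** A ** transpose A ** Y"
    unfolding Z by (simp add: Z_def matrix_transpose_mul)
  also have "\<dots> = Z ** A"
    by (metis Y matrix_mul_assoc transpose_transpose)
  finally have ZA: "transpose (Z ** A) = Z ** A" .
  have AZA: "A ** Z ** A = A"
    by (metis ZA Z Z_def matrix_mul_assoc matrix_transpose_mul transpose_transpose Y)
  have AZA': "M ** A ** Z ** A = M ** A" for M :: "real^'n^'k"
    by (metis AZA matrix_mul_assoc)
  have AXA': "M ** A ** X ** A = M ** A" for M :: "real^'n^'k"
    by (metis AXA matrix_mul_assoc)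
  have "is_pinv A (Z ** A ** X)"
    unfolding is_pinv_def matrix_mul_assoc
    by (simp add: AZA AXA AX ZA AXA' AZA')
  then show thesis by (rule that)
qed

lemma is_pinv_unique:
  assumes B: "is_pinv A B" and C: "is_pinv A C"
  shows "B = C"
proof -
  have "B = B ** transpose (A ** B)"
    using B by (simp add: is_pinv_def matrix_mul_assoc)
  also have "\<dots> = B ** transpose (A ** B) ** transpose (A ** C)"
    using C unfolding is_pinv_def by (metis matrix_mul_assoc matrix_transpose_mul)
  also have "\<dots> = B ** A ** C"
    using B C unfolding is_pinv_def by (metis matrix_mul_assoc)
  also have "\<dots> = transpose (B ** A) ** transpose (C ** A) ** C"
    using B C unfolding is_pinv_def by (metis matrix_mul_assoc)
  also have "\<dots> = transpose (C ** A) ** C"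
    using B unfolding is_pinv_def by (metis matrix_mul_assoc matrix_transpose_mul)
  also have "\<dots> = C"
    using C by (simp add: is_pinv_def)
  finally show ?thesis .
qed

lemma is_pinv_pinv: "is_pinv A (pinv A)"
  unfolding pinv_def
  by (metis is_pinv_exists is_pinv_unique theI)

lemma pinv_inner: "A ** pinv A ** A = A"
  and pinv_outer: "pinv A ** A ** pinv A = pinv A"
  and transpose_pinv_mul_self: "transpose (pinv A ** A) = pinv A ** A"
  using is_pinv_pinv[of A] by (auto simp: is_pinv_def)

text \<open>
  Both sides are the orthogonal projection to the orthogonal complement of the kernel, and \<open>B\<close> and
  \<open>P B\<close> have the same kernel. In matrix terms: symmetric matrices \<open>N\<close>, \<open>N'\<close> with \<open>N N' = N\<close> and
  \<open>N' N = N'\<close> are equal, since \<open>N' N = (N N')\<^sup>T = N\<close>.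
\<close>

lemma pinv_mul_left_invertible:
  fixes B :: "real^'k^'n" and P :: "real^'n^'m"
  assumes "Q ** P = mat 1"
  shows "pinv (P ** B) ** (P ** B) = pinv B ** B"
proof -
  let ?B' = "P ** B"
  let ?N = "pinv B ** B" and ?N' = "pinv ?B' ** ?B'"
  have B: "B = Q ** ?B'"
    by (simp add: matrix_mul_assoc assms)
  have "B ** ?N' = Q ** (?B' ** pinv ?B' ** ?B')"
    by (metis B matrix_mul_assoc)
  then have "B ** ?N' = B"
    by (simp only: pinv_inner flip: B)
  then have 1: "?N ** ?N' = ?N"
    by (metis matrix_mul_assoc)
  have 2: "?N' ** ?N = ?N'"
    by (metis matrix_mul_assoc pinv_inner)
  have "?N' ** ?N = transpose (?N ** ?N')"
    by (simp only: matrix_transpose_mul[of ?N] transpose_pinv_mul_self)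
  also have "\<dots> = ?N"
    by (simp only: 1 transpose_pinv_mul_self)
  finally show ?thesis
    using 2 by simp
qed

text \<open>
  The inverse \<open>(P B)\<^sup>+\<close> is not \<open>B\<^sup>+ Q\<close> in general. The two do agree on the range of \<open>P B\<close>, where they
  pick the preimage that is orthogonal to the common kernel of \<open>B\<close> and \<open>P B\<close>. This makes the
  particular solution \<open>B\<^sup>+ F\<close> covariant as soon as the equation \<open>B \<Omega> = F\<close> is solvable.
\<close>

lemma pinv_solution_covariant:
  fixes B :: "real^'k^'n" and P :: "real^'n^'m"
  assumes "Q ** P = mat 1" and "F = B ** pinv B ** F"
  shows "pinv (P ** B) ** (P ** F ** J) = pinv B ** F ** J"
proof -
  have "pinv (P ** B) ** (P ** F ** J) = pinv (P ** B) ** (P ** B) ** pinv B ** F ** J"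
    by (metis assms(2) matrix_mul_assoc)
  then show ?thesis
    by (simp add: pinv_mul_left_invertible[OF assms(1)] pinv_outer)
qed

section \<open>Smooth maps\<close>

text \<open>
  The derivatives are taken in the whole space and not within \<open>S\<close>, so that openness is what makes
  smoothness depend on the values in \<open>S\<close> only. The closure properties below rest on this: a rule of
  differentiation identifies the derivative with an explicit map at the points of \<open>S\<close> only.
\<close>

lemma Ck_on_cong:
  assumes "open S" "\<And>x. x \<in> S \<Longrightarrow> f x = g x" "Ck_on k S f"
  shows "Ck_on k S g"
  using assms(2,3)
proof (induction k arbitrary: f g)
  case 0
  then show ?case by (simp cong: continuous_on_cong)
next
  case (Suc k)
  have d: "(g has_derivative frechet_derivative f (at x)) (at x)" if "x \<in> S" for x
    using Suc.prems that assms(1)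
    by (auto simp: frechet_derivative_works intro: has_derivative_transform_within_open)
  have eq: "frechet_derivative f (at x) v = frechet_derivative g (at x) v" if "x \<in> S" for x v
    using frechet_derivative_at[OF d[OF that]] by simp
  have "Ck_on k S (\<lambda>x. frechet_derivative g (at x) v)" for v
    by (rule Suc.IH[of "\<lambda>x. frechet_derivative f (at x) v"]) (use Suc.prems eq in auto)
  then show ?case
    using d by (auto simp: differentiable_def)
qed

lemma smooth_on_cong:
  assumes "open S" "\<And>x. x \<in> S \<Longrightarrow> f x = g x" "smooth_on S f"
  shows "smooth_on S g"
  using assms Ck_on_cong unfolding smooth_on_def by blast

lemma Ck_on_SucI:
  assumes "open S" "\<And>x. x \<in> S \<Longrightarrow> (f has_derivative f' x) (at x)" "\<And>v. Ck_on k S (\<lambda>x. f' x v)"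
  shows "Ck_on (Suc k) S f"
proof -
  have "f' x = frechet_derivative f (at x)" if "x \<in> S" for x
    using assms(2)[OF that] by (rule frechet_derivative_at)
  then have "Ck_on k S (\<lambda>x. frechet_derivative f (at x) v)" for v
    using assms(1,3) by (auto intro: Ck_on_cong[where f="\<lambda>x. f' x v"])
  then show ?thesis
    using assms(2) by (auto simp: differentiable_def)
qed

lemma Ck_on_SucD:
  assumes "Ck_on (Suc k) S f"
  shows "Ck_on k S f"
  using assms
proof (induction k arbitrary: f)
  case 0
  then show ?case
    by (auto simp: intro!: continuous_at_imp_continuous_on differentiable_imp_continuous_within)
next
  case (Suc k)
  then show ?case by (auto simp del: Ck_on.simps(2) simp: Ck_on.simps(2)[of _ S f])
qed

lemma Ck_on_add:
  assumes "open S" "Ck_on k S f" "Ck_on k S g"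
  shows "Ck_on k S (\<lambda>x. f x + g x)"
  using assms(2,3)
proof (induction k arbitrary: f g)
  case 0
  then show ?case by (auto intro: continuous_intros)
next
  case (Suc k)
  show ?case
    by (rule Ck_on_SucI[OF assms(1), where f'="\<lambda>x v. frechet_derivative f (at x) v + frechet_derivative g (at x) v"])
      (use Suc in \<open>auto simp: frechet_derivative_works intro!: derivative_intros\<close>)
qed

lemma Ck_on_bounded_linear:
  assumes "open S" "bounded_linear L" "Ck_on k S f"
  shows "Ck_on k S (\<lambda>x. L (f x))"
  using assms(3)
proof (induction k arbitrary: f)
  case 0
  then show ?case by (auto intro: bounded_linear.continuous_on[OF assms(2)])
next
  case (Suc k)
  show ?case
    by (rule Ck_on_SucI[OF assms(1), where f'="\<lambda>x v. L (frechet_derivative f (at x) v)"])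
      (use Suc in \<open>auto simp: frechet_derivative_works intro!: bounded_linear.has_derivative[OF assms(2)]\<close>)
qed

lemma Ck_on_bounded_bilinear:
  assumes "open S" "bounded_bilinear h" "Ck_on k S f" "Ck_on k S g"
  shows "Ck_on k S (\<lambda>x. h (f x) (g x))"
  using assms(3,4)
proof (induction k arbitrary: f g)
  case 0
  then show ?case by (auto intro: bounded_bilinear.continuous_on[OF assms(2)])
next
  case (Suc k)
  have fg: "Ck_on k S f" "Ck_on k S g"
    using Suc.prems by (auto intro: Ck_on_SucD)
  show ?case
  proof (rule Ck_on_SucI[OF assms(1)])
    fix x assume "x \<in> S"
    then show "((\<lambda>x. h (f x) (g x)) has_derivative
        (\<lambda>v. h (f x) (frechet_derivative g (at x) v) + h (frechet_derivative f (at x) v) (g x))) (at x)"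
      using Suc.prems
      by (auto simp: frechet_derivative_works intro!: bounded_bilinear.FDERIV[OF assms(2)])
  next
    show "Ck_on k S (\<lambda>x. h (f x) (frechet_derivative g (at x) v) + h (frechet_derivative f (at x) v) (g x))" for v
      using Suc.prems fg by (intro Ck_on_add[OF assms(1)] Suc.IH) auto
  qed
qed

lemma smooth_on_const: "smooth_on S (\<lambda>x. c)"
proof -
  have "Ck_on k S (\<lambda>x. c)" for k
    by (induction k arbitrary: c) auto
  then show ?thesis by (simp add: smooth_on_def)
qed

lemma smooth_on_bounded_linear:
  assumes "open S" "bounded_linear L" "smooth_on S f"
  shows "smooth_on S (\<lambda>x. L (f x))"
  using assms by (simp add: smooth_on_def Ck_on_bounded_linear)

lemma smooth_on_bounded_bilinear:
  assumes "open S" "bounded_bilinear h" "smooth_on S f" "smooth_on S g"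
  shows "smooth_on S (\<lambda>x. h (f x) (g x))"
  using assms by (simp add: smooth_on_def Ck_on_bounded_bilinear)

lemma smooth_on_add:
  assumes "open S" "smooth_on S f" "smooth_on S g"
  shows "smooth_on S (\<lambda>x. f x + g x)"
  using assms by (simp add: smooth_on_def Ck_on_add)

lemma smooth_on_diff:
  assumes "open S" "smooth_on S f" "smooth_on S g"
  shows "smooth_on S (\<lambda>x. f x - g x)"
  using smooth_on_add[OF assms(1,2) smooth_on_bounded_linear[OF assms(1) _ assms(3), of uminus]]
  by (simp add: bounded_linear_minus[OF bounded_linear_ident])

lemma smooth_on_sum:
  assumes "open S" "\<And>i. i \<in> I \<Longrightarrow> smooth_on S (f i)"
  shows "smooth_on S (\<lambda>x. \<Sum>i\<in>I. f i x)"
  using assms(2)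
  by (induction I rule: infinite_finite_induct) (auto intro: smooth_on_const smooth_on_add[OF assms(1)])

lemma smooth_on_differentiable:
  assumes "smooth_on S f" "x \<in> S"
  shows "f differentiable (at x)"
  using assms unfolding smooth_on_def by (metis Ck_on.simps(2))

lemma smooth_on_frechet_derivative:
  assumes "smooth_on S f"
  shows "smooth_on S (\<lambda>x. frechet_derivative f (at x) v)"
  using assms unfolding smooth_on_def by (metis Ck_on.simps(2))

lemma smooth_on_vec_nth:
  assumes "open S" "smooth_on S f"
  shows "smooth_on S (\<lambda>x. f x $ i)"
  using assms by (rule smooth_on_bounded_linear[OF _ bounded_linear_vec_nth])

lemma smooth_on_vec_lambda:
  fixes f :: "'a::real_normed_vector \<Rightarrow> 'n::finite \<Rightarrow> 'b::euclidean_space"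
  assumes "open S" "\<And>i. smooth_on S (\<lambda>x. f x i)"
  shows "smooth_on S (\<lambda>x. \<chi> i. f x i)"
proof -
  have ax: "bounded_linear (axis i :: 'b \<Rightarrow> 'b^'n)" for i
    by (rule linear_conv_bounded_linear[THEN iffD1])
      (auto intro!: linearI simp: axis_def vec_eq_iff)
  have "smooth_on S (\<lambda>x. \<Sum>i\<in>UNIV. axis i (f x i))"
    using assms by (intro smooth_on_sum smooth_on_bounded_linear[OF _ ax])
  moreover have "(\<Sum>i\<in>UNIV. axis i (f x i)) = (\<chi> i. f x i)" for x
    by (simp add: vec_eq_iff axis_def)
  ultimately show ?thesis by simp
qed

section \<open>Symmetry of second derivatives\<close>

text \<open>
  The mean value theorem is applied twice: to \<open>r \<mapsto> f (x + r u + t v) - f (x + r u)\<close>, and then, in the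
  direction \<open>v\<close>, to the derivative of \<open>f\<close> along \<open>u\<close>. The second difference is symmetric in \<open>u\<close> and \<open>v\<close>,
  while the second derivative that it produces is taken in a fixed order.
\<close>

lemma second_difference_mean_value:
  fixes f :: "'a::real_normed_vector \<Rightarrow> real"
  assumes "0 < t"
    and f: "\<And>r s. 0 \<le> r \<Longrightarrow> r \<le> t \<Longrightarrow> 0 \<le> s \<Longrightarrow> s \<le> t \<Longrightarrow> f differentiable (at (x + r *\<^sub>R u + s *\<^sub>R v))"
    and Df: "\<And>r s. 0 \<le> r \<Longrightarrow> r \<le> t \<Longrightarrow> 0 \<le> s \<Longrightarrow> s \<le> t \<Longrightarrow>
      (\<lambda>y. frechet_derivative f (at y) u) differentiable (at (x + r *\<^sub>R u + s *\<^sub>R v))"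
  obtains r s where "0 < r" "r < t" "0 < s" "s < t"
    "f (x + t *\<^sub>R u + t *\<^sub>R v) - f (x + t *\<^sub>R u) - f (x + t *\<^sub>R v) + f x =
     t * t * frechet_derivative (\<lambda>y. frechet_derivative f (at y) u) (at (x + r *\<^sub>R u + s *\<^sub>R v)) v"
proof -
  have along: "((\<lambda>r. g (p + r *\<^sub>R w)) has_real_derivative frechet_derivative g (at (p + r *\<^sub>R w)) w) (at r)"
    if "g differentiable (at (p + r *\<^sub>R w))" for g :: "'a \<Rightarrow> real" and p w r
  proof -
    have "((\<lambda>r. g (p + r *\<^sub>R w)) has_derivative (\<lambda>h. frechet_derivative g (at (p + r *\<^sub>R w)) (h *\<^sub>R w))) (at r)"
      by (rule has_derivative_compose[of "\<lambda>r. p + r *\<^sub>R w"])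
        (use that in \<open>auto simp: frechet_derivative_works intro!: derivative_eq_intros\<close>)
    moreover have "frechet_derivative g (at (p + r *\<^sub>R w)) (h *\<^sub>R w) = h * frechet_derivative g (at (p + r *\<^sub>R w)) w" for h
      using linear_frechet_derivative[OF that] by (simp add: linear_scale)
    ultimately show ?thesis
      unfolding has_field_derivative_def by (auto elim!: has_derivative_eq_rhs simp: mult.commute)
  qed
  let ?D = "\<lambda>y. frechet_derivative f (at y) u"
  let ?g = "\<lambda>r. f (x + r *\<^sub>R u + t *\<^sub>R v) - f (x + r *\<^sub>R u)"
  have "(?g has_real_derivative ?D (x + r *\<^sub>R u + t *\<^sub>R v) - ?D (x + r *\<^sub>R u)) (at r)"
    if "0 \<le> r" "r \<le> t" for r
  proof (rule DERIV_diff)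
    have "f differentiable (at (x + t *\<^sub>R v + r *\<^sub>R u))"
      using f[OF that, of t] \<open>0 < t\<close> by (simp add: algebra_simps)
    from along[OF this]
    show "((\<lambda>r. f (x + r *\<^sub>R u + t *\<^sub>R v)) has_real_derivative ?D (x + r *\<^sub>R u + t *\<^sub>R v)) (at r)"
      by (simp add: algebra_simps)
    show "((\<lambda>r. f (x + r *\<^sub>R u)) has_real_derivative ?D (x + r *\<^sub>R u)) (at r)"
      using along[of f x r u] f[OF that, of 0] \<open>0 < t\<close> by simp
  qed
  from MVT2[OF \<open>0 < t\<close> this]
  obtain r where r: "0 < r" "r < t"
    and 1: "?g t - ?g 0 = (t - 0) * (?D (x + r *\<^sub>R u + t *\<^sub>R v) - ?D (x + r *\<^sub>R u))"
    by blast
  have "((\<lambda>s. ?D (x + r *\<^sub>R u + s *\<^sub>R v)) has_real_derivative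
      frechet_derivative ?D (at (x + r *\<^sub>R u + s *\<^sub>R v)) v) (at s)" if "0 \<le> s" "s \<le> t" for s
    using along[of ?D "x + r *\<^sub>R u" s v] Df[of r s] r that by simp
  from MVT2[OF \<open>0 < t\<close> this]
  obtain s where s: "0 < s" "s < t"
    and 2: "?D (x + r *\<^sub>R u + t *\<^sub>R v) - ?D (x + r *\<^sub>R u + 0 *\<^sub>R v)
      = (t - 0) * frechet_derivative ?D (at (x + r *\<^sub>R u + s *\<^sub>R v)) v"
    by blast
  show thesis
    using that[OF r s] 1 2 by (simp add: algebra_simps)
qed

text \<open>
  Schwarz's theorem. For small \<open>t\<close> the same second difference equals \<open>t\<^sup>2\<close> times either mixed
  derivative, each taken at some point near \<open>x\<close>. If the two mixed derivatives differed at \<open>x\<close>, each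
  would by continuity stay closer to its value at \<open>x\<close> than half of the distance of these values, so
  that they could not agree near \<open>x\<close>, at whatever points they are taken.
\<close>

lemma second_derivative_symmetric_real:
  fixes f :: "'a::real_normed_vector \<Rightarrow> real"
  assumes S: "open S" "x \<in> S" and f: "Ck_on 2 S f"
  shows "frechet_derivative (\<lambda>y. frechet_derivative f (at y) u) (at x) v =
         frechet_derivative (\<lambda>y. frechet_derivative f (at y) v) (at x) u"
proof (rule ccontr)
  let ?D2 = "\<lambda>u v y. frechet_derivative (\<lambda>y. frechet_derivative f (at y) u) (at y) v"
  assume ne: "?D2 u v x \<noteq> ?D2 v u x"
  define e where "e = \<bar>?D2 u v x - ?D2 v u x\<bar> / 2"
  have "e > 0" using ne by (simp add: e_def)
  have C2: "f differentiable (at y)" "(\<lambda>y. frechet_derivative f (at y) w) differentiable (at y)"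
    if "y \<in> S" for y w
    using f that by (auto simp: numeral_2_eq_2)
  have cont: "continuous_on S (?D2 w z)" for w z
    using f by (simp add: numeral_2_eq_2)
  have near: "\<exists>d>0. \<forall>y. dist y x < d \<longrightarrow> y \<in> S \<and> \<bar>?D2 w z y - ?D2 w z x\<bar> < e" for w z
  proof -
    obtain d1 where "d1 > 0" "ball x d1 \<subseteq> S"
      using S open_contains_ball by blast
    moreover obtain d2 where "d2 > 0" "\<forall>y\<in>S. dist y x < d2 \<longrightarrow> \<bar>?D2 w z y - ?D2 w z x\<bar> < e"
      using cont[of w z] S(2) \<open>e > 0\<close> unfolding continuous_on_iff dist_real_def by metis
    ultimately show ?thesis
      by (intro exI[of _ "min d1 d2"]) (auto simp: ball_def dist_commute)
  qed
  obtain d1 where d1: "d1 > 0" "\<And>y. dist y x < d1 \<Longrightarrow> y \<in> S \<and> \<bar>?D2 u v y - ?D2 u v x\<bar> < e"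
    using near[of u v] by auto
  obtain d2 where d2: "d2 > 0" "\<And>y. dist y x < d2 \<Longrightarrow> y \<in> S \<and> \<bar>?D2 v u y - ?D2 v u x\<bar> < e"
    using near[of v u] by auto
  \<comment> \<open>\<open>t\<close> is such that \<open>x + r u + s v\<close> is close to \<open>x\<close> for \<open>r, s \<in> [0, t]\<close>;
    the summand \<open>1\<close> avoids division by zero when \<open>u = v = 0\<close>\<close>
  define N where "N = norm u + norm v + 1"
  define t where "t = min d1 d2 / (2 * N)"
  have pos: "N > 0"
    by (simp add: N_def add_nonneg_pos)
  have "t > 0"
    using d1(1) d2(1) pos by (simp add: t_def)
  have "t * N = min d1 d2 / 2"
    using pos by (simp add: t_def)
  moreover have "t * (norm u + norm v) \<le> t * N"
    using \<open>t > 0\<close> by (intro mult_left_mono) (auto simp: N_def)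
  ultimately have "t * (norm u + norm v) < min d1 d2"
    using d1(1) d2(1) by linarith
  then have small: "t * norm u + t * norm v < min d1 d2"
    by (simp only: distrib_left)
  have close: "dist (x + r *\<^sub>R u + s *\<^sub>R v) x < min d1 d2"
    if "0 \<le> r" "r \<le> t" "0 \<le> s" "s \<le> t" for r s
  proof -
    have "dist (x + r *\<^sub>R u + s *\<^sub>R v) x \<le> r * norm u + s * norm v"
      using that norm_triangle_ineq[of "r *\<^sub>R u" "s *\<^sub>R v"] by (simp add: dist_norm add.assoc)
    also have "\<dots> \<le> t * norm u + t * norm v"
      using that by (intro add_mono mult_right_mono) auto
    finally show ?thesis using small by simp
  qed
  have close': "dist (x + r *\<^sub>R v + s *\<^sub>R u) x < min d1 d2"
    if "0 \<le> r" "r \<le> t" "0 \<le> s" "s \<le> t" for r s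
    using close[of s r] that by (simp add: algebra_simps)
  let ?\<Delta> = "f (x + t *\<^sub>R u + t *\<^sub>R v) - f (x + t *\<^sub>R u) - f (x + t *\<^sub>R v) + f x"
  obtain r s where rs: "0 < r" "r < t" "0 < s" "s < t"
    and uv: "?\<Delta> = t * t * ?D2 u v (x + r *\<^sub>R u + s *\<^sub>R v)"
  proof (rule second_difference_mean_value[OF \<open>0 < t\<close>, of f x u v])
    show "f differentiable (at (x + r *\<^sub>R u + s *\<^sub>R v))"
      "(\<lambda>y. frechet_derivative f (at y) u) differentiable (at (x + r *\<^sub>R u + s *\<^sub>R v))"
      if "0 \<le> r" "r \<le> t" "0 \<le> s" "s \<le> t" for r s
      using d1(2)[of "x + r *\<^sub>R u + s *\<^sub>R v"] close[OF that] C2 by auto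
  qed
  obtain r' s' where rs': "0 < r'" "r' < t" "0 < s'" "s' < t"
    and vu: "f (x + t *\<^sub>R v + t *\<^sub>R u) - f (x + t *\<^sub>R v) - f (x + t *\<^sub>R u) + f x =
      t * t * ?D2 v u (x + r' *\<^sub>R v + s' *\<^sub>R u)"
  proof (rule second_difference_mean_value[OF \<open>0 < t\<close>, of f x v u])
    show "f differentiable (at (x + r *\<^sub>R v + s *\<^sub>R u))"
      "(\<lambda>y. frechet_derivative f (at y) v) differentiable (at (x + r *\<^sub>R v + s *\<^sub>R u))"
      if "0 \<le> r" "r \<le> t" "0 \<le> s" "s \<le> t" for r s
      using d1(2)[of "x + r *\<^sub>R v + s *\<^sub>R u"] close'[OF that] C2 by auto
  qed
  have tri: "\<bar>a - b\<bar> < 2 * e" if "p = q" "\<bar>p - a\<bar> < e" "\<bar>q - b\<bar> < e" for a b p q :: real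
    using that by linarith
  have "t * t * ?D2 u v (x + r *\<^sub>R u + s *\<^sub>R v) = t * t * ?D2 v u (x + r' *\<^sub>R v + s' *\<^sub>R u)"
    using uv vu by (simp add: algebra_simps)
  then have "?D2 u v (x + r *\<^sub>R u + s *\<^sub>R v) = ?D2 v u (x + r' *\<^sub>R v + s' *\<^sub>R u)"
    using \<open>t > 0\<close> by simp
  moreover have "\<bar>?D2 u v (x + r *\<^sub>R u + s *\<^sub>R v) - ?D2 u v x\<bar> < e"
    using d1(2)[of "x + r *\<^sub>R u + s *\<^sub>R v"] close[of r s] rs by simp
  moreover have "\<bar>?D2 v u (x + r' *\<^sub>R v + s' *\<^sub>R u) - ?D2 v u x\<bar> < e"
    using d2(2)[of "x + r' *\<^sub>R v + s' *\<^sub>R u"] close'[of r' s'] rs' by simp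
  ultimately have "\<bar>?D2 u v x - ?D2 v u x\<bar> < 2 * e"
    by (rule tri)
  then show False
    by (simp add: e_def)
qed

lemma frechet_derivative_bounded_linear_comp:
  assumes "bounded_linear L" "f differentiable (at x)"
  shows "frechet_derivative (\<lambda>y. L (f y)) (at x) v = L (frechet_derivative f (at x) v)"
  using frechet_derivative_at[OF bounded_linear.has_derivative[OF assms(1)
    assms(2)[unfolded frechet_derivative_works]]] by metis

text \<open>
  Pairing with a fixed vector reduces this to real-valued maps.
\<close>

lemma second_derivative_symmetric:
  fixes f :: "'a::real_normed_vector \<Rightarrow> 'b::real_inner"
  assumes S: "open S" "x \<in> S" and f: "Ck_on 2 S f"
  shows "frechet_derivative (\<lambda>y. frechet_derivative f (at y) u) (at x) v =
         frechet_derivative (\<lambda>y. frechet_derivative f (at y) v) (at x) u"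
proof (rule vector_eq_rdot[THEN iffD1], rule allI)
  fix w :: 'b
  have L: "bounded_linear (\<lambda>z. z \<bullet> w)"
    by (rule bounded_linear_inner_left)
  have 1: "frechet_derivative (\<lambda>y. f y \<bullet> w) (at y) u = frechet_derivative f (at y) u \<bullet> w"
    if "y \<in> S" for y u
    by (rule frechet_derivative_bounded_linear_comp[OF L]) (use f that in \<open>simp add: numeral_2_eq_2\<close>)
  have 2: "frechet_derivative (\<lambda>y. frechet_derivative (\<lambda>y. f y \<bullet> w) (at y) u) (at x) v =
      frechet_derivative (\<lambda>y. frechet_derivative f (at y) u) (at x) v \<bullet> w" for u v
  proof -
    have d: "(\<lambda>y. frechet_derivative f (at y) u) differentiable (at x)"
      using f S(2) by (auto simp: numeral_2_eq_2)
    have "frechet_derivative (\<lambda>y. frechet_derivative f (at y) u \<bullet> w) (at x) =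
        frechet_derivative (\<lambda>y. frechet_derivative (\<lambda>y. f y \<bullet> w) (at y) u) (at x)"
      by (rule frechet_derivative_transform_within_open[OF _ S])
        (auto simp: 1 intro: differentiable_compose[OF bounded_linear_imp_differentiable[OF L] d])
    then show ?thesis
      using frechet_derivative_bounded_linear_comp[OF L d] by metis
  qed
  show "frechet_derivative (\<lambda>y. frechet_derivative f (at y) u) (at x) v \<bullet> w =
        frechet_derivative (\<lambda>y. frechet_derivative f (at y) v) (at x) u \<bullet> w"
    using second_derivative_symmetric_real[OF S Ck_on_bounded_linear[OF S(1) L f], of u v]
    by (simp add: 2)
qed

section \<open>Naturality of the Lie derivative\<close>

lemma jacobian_mul_vec:
  fixes f :: "real^'n \<Rightarrow> real^'m"
  assumes "f differentiable (at x)"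
  shows "jacobian f (at x) *v h = frechet_derivative f (at x) h"
  using assms frechet_derivative_at jacobian_works by metis

lemma pderiv_at_vec_nth:
  assumes "f differentiable (at x)"
  shows "pderiv_at \<mu> (\<lambda>y. f y $ i) x = jacobian f (at x) $ i $ \<mu>"
  unfolding pderiv_at_def jacobian_def matrix_def
  using frechet_derivative_bounded_linear_comp[OF bounded_linear_vec_nth assms]
  by simp

text \<open>
  With \<open>V\<close> the Jacobian matrix of \<open>v\<close>, the coordinate formula reads
  \<open>\<L>\<^sub>v E = DE(v) + V\<^sup>T E + E V\<close>. In this form, the change of coordinates below is a computation in the
  matrix algebra, without indices.
\<close>

lemma lie_deriv_matrix:
  fixes v :: "real^'n \<Rightarrow> real^'n" and E :: "real^'n \<Rightarrow> real^'n^'n"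
  assumes v: "v differentiable (at x)" and E: "E differentiable (at x)"
  shows "lie_deriv v E x = frechet_derivative E (at x) (v x)
    + transpose (jacobian v (at x)) ** E x + E x ** jacobian v (at x)"
proof -
  have dE: "(\<Sum>\<kappa>\<in>UNIV. v x $ \<kappa> * pderiv_at \<kappa> (\<lambda>y. E y $ \<mu> $ \<nu>) x) =
      frechet_derivative E (at x) (v x) $ \<mu> $ \<nu>" for \<mu> \<nu>
  proof -
    have L: "bounded_linear (\<lambda>M::real^'n^'n. M $ \<mu> $ \<nu>)"
      by (rule bounded_linear_compose[OF bounded_linear_vec_nth bounded_linear_vec_nth])
    have "pderiv_at \<kappa> (\<lambda>y. E y $ \<mu> $ \<nu>) x = frechet_derivative E (at x) (axis \<kappa> 1) $ \<mu> $ \<nu>" for \<kappa>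
      unfolding pderiv_at_def by (rule frechet_derivative_bounded_linear_comp[OF L E])
    moreover have "frechet_derivative E (at x) (v x) =
        (\<Sum>\<kappa>\<in>UNIV. v x $ \<kappa> *\<^sub>R frechet_derivative E (at x) (axis \<kappa> 1))"
      using linear_frechet_derivative[OF E]
      by (subst basis_expansion[symmetric, of "v x"])
        (simp add: linear_sum linear_scale scalar_mult_eq_scaleR)
    ultimately show ?thesis by simp
  qed
  show ?thesis
    by (simp add: vec_eq_iff lie_deriv_def sum.distrib dE pderiv_at_vec_nth[OF v]
      matrix_matrix_mult_def transpose_def mult.commute)
qed

lemma smooth_on_pderiv_at:
  "smooth_on S f \<Longrightarrow> smooth_on S (\<lambda>x. pderiv_at \<mu> f x)"
  unfolding pderiv_at_def by (rule smooth_on_frechet_derivative)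

lemma smooth_on_lie_deriv:
  assumes "open S" "smooth_on S v" "smooth_on S E"
  shows "smooth_on S (\<lambda>x. lie_deriv v E x)"
  unfolding lie_deriv_def
  by (intro smooth_on_vec_lambda smooth_on_sum smooth_on_add smooth_on_pderiv_at
      smooth_on_bounded_bilinear[OF _ bounded_bilinear_mult] smooth_on_vec_nth assms)

lemma smooth_on_jacobian:
  fixes f :: "real^'n \<Rightarrow> real^'m"
  assumes "open S" "smooth_on S f"
  shows "smooth_on S (\<lambda>x. jacobian f (at x))"
  unfolding jacobian_def matrix_def
  by (intro smooth_on_vec_lambda smooth_on_vec_nth smooth_on_frechet_derivative assms)

lemma jacobian_derivative_symmetric:
  fixes f :: "real^'n \<Rightarrow> real^'m"
  assumes S: "open S" "x \<in> S" and f: "smooth_on S f"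
  defines "J' \<equiv> frechet_derivative (\<lambda>y. jacobian f (at y)) (at x)"
  shows "J' u *v v = J' v *v u"
proof -
  have d: "(\<lambda>y. jacobian f (at y)) differentiable (at x)"
    using smooth_on_differentiable[OF smooth_on_jacobian[OF S(1) f] S(2)] .
  have L: "bounded_linear (\<lambda>M::real^'n^'m. M *v v)" for v
    by (rule linear_conv_bounded_linear[THEN iffD1])
      (auto intro!: linearI simp: matrix_vector_mult_add_rdistrib scaleR_matrix_vector_assoc)
  have "J' u *v v = frechet_derivative (\<lambda>y. frechet_derivative f (at y) v) (at x) u" for u v
  proof -
    have "J' u *v v = frechet_derivative (\<lambda>y. jacobian f (at y) *v v) (at x) u"
      unfolding J'_def by (rule frechet_derivative_bounded_linear_comp[OF L d, symmetric])
    also have "frechet_derivative (\<lambda>y. jacobian f (at y) *v v) (at x) =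
        frechet_derivative (\<lambda>y. frechet_derivative f (at y) v) (at x)"
      by (rule frechet_derivative_transform_within_open[OF _ S])
        (auto intro: differentiable_compose[OF bounded_linear_imp_differentiable[OF L] d]
          jacobian_mul_vec smooth_on_differentiable[OF f])
    finally show ?thesis .
  qed
  moreover have "Ck_on 2 S f"
    using f by (simp add: smooth_on_def)
  ultimately show ?thesis
    using second_derivative_symmetric[OF S, of f u v] by metis
qed

lemma bounded_bilinear_matrix_vector_mul:
  "bounded_bilinear ((*v) :: real^'k^'n \<Rightarrow> real^'k \<Rightarrow> real^'n)"
  by (rule bilinear_conv_bounded_bilinear[THEN iffD1])
    (auto simp: bilinear_def matrix_vector_mult_def vec_eq_iff sum.distrib sum_distrib_left
      algebra_simps intro!: linearI)

text \<open>
  If \<open>v\<close> and \<open>w\<close> are \<open>\<phi>\<close>-related and \<open>E = \<phi>\<^sup>* F\<close>, then \<open>\<L>\<^sub>v E = \<phi>\<^sup>* (\<L>\<^sub>w F)\<close>. Differentiating \<open>w \<circ> \<phi> = J v\<close> gives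
  \<open>W J h = J V h + (D\<^sub>h J) v\<close>, where \<open>V\<close> and \<open>W\<close> are the Jacobian matrices of \<open>v\<close> and \<open>w\<close>. By symmetry of the
  second derivative \<open>(D\<^sub>h J) v = (D\<^sub>v J) h\<close>, so that \<open>W J = J V + D\<^sub>v J\<close>. The terms with \<open>D\<^sub>v J\<close> that appear when
  \<open>E = J\<^sup>T (F \<circ> \<phi>) J\<close> is differentiated along \<open>v\<close> are exactly those that turn \<open>J V\<close> into \<open>W J\<close>.
\<close>

lemma lie_deriv_pullback:
  fixes \<phi> :: "real^'n \<Rightarrow> real^'m"
  assumes S: "open S" "x \<in> S" and \<phi>: "smooth_on S \<phi>"
    and v: "v differentiable (at x)" and w: "w differentiable (at (\<phi> x))"
    and F: "F differentiable (at (\<phi> x))"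
  defines "J \<equiv> \<lambda>y. jacobian \<phi> (at y)"
  assumes vw: "\<And>y. y \<in> S \<Longrightarrow> w (\<phi> y) = J y *v v y"
    and EF: "\<And>y. y \<in> S \<Longrightarrow> E y = transpose (J y) ** F (\<phi> y) ** J y"
  shows "lie_deriv v E x = transpose (J x) ** lie_deriv w F (\<phi> x) ** J x"
proof -
  define J' where "J' = frechet_derivative J (at x)"
  define V where "V = jacobian v (at x)"
  define W where "W = jacobian w (at (\<phi> x))"
  define F' where "F' = frechet_derivative F (at (\<phi> x))"
  have d\<phi>: "(\<phi> has_derivative (\<lambda>h. J x *v h)) (at x)"
    using smooth_on_differentiable[OF \<phi> S(2)] by (simp add: J_def jacobian_works)
  have dJ: "(J has_derivative J') (at x)"
    using smooth_on_differentiable[OF smooth_on_jacobian[OF S(1) \<phi>] S(2)]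
    by (simp add: J_def J'_def frechet_derivative_works)
  have dv: "(v has_derivative (\<lambda>h. V *v h)) (at x)"
    using v by (simp add: V_def jacobian_works)
  have dw: "(w has_derivative (\<lambda>h. W *v h)) (at (\<phi> x))"
    using w by (simp add: W_def jacobian_works)
  have dF: "(F has_derivative F') (at (\<phi> x))"
    using F by (simp add: F'_def frechet_derivative_works)
  have "((\<lambda>y. w (\<phi> y)) has_derivative (\<lambda>h. J x *v (V *v h) + J' h *v v x)) (at x)"
    by (rule has_derivative_transform_within_open[OF
          bounded_bilinear.FDERIV[OF bounded_bilinear_matrix_vector_mul dJ dv] S])
      (simp add: vw)
  moreover have "((\<lambda>y. w (\<phi> y)) has_derivative (\<lambda>h. W *v (J x *v h))) (at x)"
    by (rule has_derivative_compose[OF d\<phi> dw])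
  ultimately have "(\<lambda>h. W *v (J x *v h)) = (\<lambda>h. J x *v (V *v h) + J' h *v v x)"
    by (rule has_derivative_unique[rotated])
  then have "W *v (J x *v h) = J x *v (V *v h) + J' h *v v x" for h
    by (rule fun_cong)
  moreover have "J' h *v v x = J' (v x) *v h" for h
    unfolding J'_def J_def by (rule jacobian_derivative_symmetric[OF S \<phi>])
  ultimately have WJ: "W ** J x = J x ** V + J' (v x)"
    by (simp add: matrix_eq matrix_vector_mult_add_rdistrib flip: matrix_vector_mul_assoc)
  have dF\<phi>: "((\<lambda>y. F (\<phi> y)) has_derivative (\<lambda>h. F' (J x *v h))) (at x)"
    by (rule has_derivative_compose[OF d\<phi> dF])
  have dE: "(E has_derivative (\<lambda>h. transpose (J x) ** F (\<phi> x) ** J' h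
      + (transpose (J x) ** F' (J x *v h) + transpose (J' h) ** F (\<phi> x)) ** J x)) (at x)"
    by (rule has_derivative_transform_within_open[OF
          bounded_bilinear.FDERIV[OF bounded_bilinear_matrix_mul
            bounded_bilinear.FDERIV[OF bounded_bilinear_matrix_mul
              bounded_linear.has_derivative[OF bounded_linear_transpose dJ] dF\<phi>] dJ] S])
      (simp add: EF)
  have E: "E differentiable (at x)"
    using dE by (rule differentiableI)
  have dist: "transpose (A + B) = transpose A + transpose B" for A B :: "real^'n^'m"
    by (simp add: transpose_def vec_eq_iff)
  have WJ': "transpose (J x) ** transpose W = transpose V ** transpose (J x) + transpose (J' (v x))"
    using arg_cong[OF WJ, of transpose] by (simp add: matrix_transpose_mul dist)
  have 1: "transpose (J x) ** F (\<phi> x) ** W ** J x =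
      transpose (J x) ** F (\<phi> x) ** J x ** V + transpose (J x) ** F (\<phi> x) ** J' (v x)"
    by (simp add: matrix_add_ldistrib WJ flip: matrix_mul_assoc)
  have add_r: "(A + B) ** C = A ** C + B ** C" for A B :: "real^'a^'b" and C :: "real^'c^'a"
    by (rule bounded_bilinear.add_left[OF bounded_bilinear_matrix_mul])
  have 2: "transpose (J x) ** transpose W ** F (\<phi> x) ** J x =
      transpose V ** transpose (J x) ** F (\<phi> x) ** J x + transpose (J' (v x)) ** F (\<phi> x) ** J x"
    by (simp add: WJ' add_r)
  have "lie_deriv v E x = (transpose (J x) ** F (\<phi> x) ** J' (v x)
      + (transpose (J x) ** F' (J x *v v x) + transpose (J' (v x)) ** F (\<phi> x)) ** J x)
      + transpose V ** E x + E x ** V"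
    unfolding lie_deriv_matrix[OF v E] V_def frechet_derivative_at[OF dE, symmetric] ..
  moreover have "lie_deriv w F (\<phi> x) = F' (J x *v v x) + transpose W ** F (\<phi> x) + F (\<phi> x) ** W"
    unfolding lie_deriv_matrix[OF w F] W_def F'_def vw[OF S(2)] ..
  ultimately show ?thesis
    by (simp add: EF[OF S(2)] matrix_add_ldistrib add_r matrix_mul_assoc 1 2)
qed

section \<open>The generalised Killing equation at a point\<close>

text \<open>
  The equation for \<open>\<Omega>\<^sup>+\<close> is linear and involves no derivatives of \<open>\<Omega>\<^sup>+\<close>: at each point it is a matrix
  equation \<open>B \<Omega>\<^sup>+ = F\<close> with \<open>B = E\<rho>\<close>. All pointwise claims reduce to this form.
\<close>

lemma gen_killing_on_iff:
  "gen_killing_on S E \<rho> \<Omega>p \<Omega>m \<longleftrightarrow>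
    (\<forall>a. \<forall>x\<in>S. E x ** rho_mat \<rho> x ** \<Omega>p a x = killing_rhs E \<rho> \<Omega>m a x)"
proof -
  have sp: "(\<Sum>\<kappa>\<in>UNIV. \<Sum>b\<in>UNIV. E x $ \<mu> $ \<kappa> * \<rho> b x $ \<kappa> * \<Omega>p a x $ b $ \<nu>) =
      (E x ** rho_mat \<rho> x ** \<Omega>p a x) $ \<mu> $ \<nu>" for a x \<mu> \<nu>
    unfolding matrix_matrix_mult_def rho_mat_def
    by (simp add: sum_distrib_right) (rule sum.swap)
  have sm: "(\<Sum>\<kappa>\<in>UNIV. \<Sum>b\<in>UNIV. E x $ \<kappa> $ \<nu> * \<rho> b x $ \<kappa> * \<Omega>m a x $ b $ \<mu>) =
      transpose (transpose (E x) ** rho_mat \<rho> x ** \<Omega>m a x) $ \<mu> $ \<nu>" for a x \<mu> \<nu>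
    unfolding matrix_matrix_mult_def rho_mat_def transpose_def
    by (simp add: sum_distrib_right) (rule sum.swap)
  show ?thesis
    unfolding gen_killing_on_def sp sm killing_rhs_def
    by (simp add: vec_eq_iff algebra_simps) metis
qed

lemma gen_killing_on_imp_solvability_on:
  assumes "gen_killing_on S E \<rho> \<Omega>p \<Omega>m"
  shows "solvability_on S E \<rho> \<Omega>m"
  unfolding solvability_on_def
proof (intro allI ballI)
  fix a x assume "x \<in> S"
  then have eq: "killing_rhs E \<rho> \<Omega>m a x = E x ** rho_mat \<rho> x ** \<Omega>p a x"
    using assms by (simp add: gen_killing_on_iff)
  show "killing_rhs E \<rho> \<Omega>m a x =
      E x ** rho_mat \<rho> x ** pinv (E x ** rho_mat \<rho> x) ** killing_rhs E \<rho> \<Omega>m a x"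
    unfolding eq by (metis matrix_mul_assoc pinv_inner)
qed

lemma gen_killing_on_solution_formula:
  assumes "solvability_on S E \<rho> \<Omega>m"
  shows "gen_killing_on S E \<rho> (solution_formula E \<rho> \<Omega>m X) \<Omega>m"
  unfolding gen_killing_on_iff
proof (intro allI ballI)
  fix a x assume x: "x \<in> S"
  let ?B = "E x ** rho_mat \<rho> x"
  have "?B ** (pinv ?B ** ?B) = ?B"
    using pinv_inner[of ?B] by (simp only: matrix_mul_assoc)
  then have "?B ** (mat 1 - pinv ?B ** ?B) = 0"
    by (simp only: matrix_mul_diff_right matrix_mul_rid diff_self)
  then have "?B ** ((mat 1 - pinv ?B ** ?B) ** X a x) = 0"
    by (simp add: matrix_mul_assoc bounded_bilinear.zero_left[OF bounded_bilinear_matrix_mul])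
  then show "?B ** solution_formula E \<rho> \<Omega>m X a x = killing_rhs E \<rho> \<Omega>m a x"
    using assms x by (simp add: solution_formula_def matrix_add_ldistrib solvability_on_def matrix_mul_assoc)
qed

text \<open>
  Every solution arises from the formula by taking the solution itself for the free parameter: the
  two terms with \<open>B\<^sup>+ B \<Omega>\<^sup>+\<close> cancel. In particular the parameter is as smooth as the solution.
\<close>

lemma solution_formula_self:
  assumes "gen_killing_on S E \<rho> \<Omega>p \<Omega>m" "x \<in> S"
  shows "solution_formula E \<rho> \<Omega>m \<Omega>p a x = \<Omega>p a x"
proof -
  have "killing_rhs E \<rho> \<Omega>m a x = E x ** rho_mat \<rho> x ** \<Omega>p a x"
    using assms by (simp add: gen_killing_on_iff)
  then show ?thesis
    by (simp add: solution_formula_def matrix_mul_diff_left matrix_mul_assoc)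
qed

lemma smooth_on_killing_rhs:
  assumes S: "open S" and E: "smooth_on S E" and \<rho>: "\<And>b. smooth_on S (\<rho> b)" and \<Omega>: "smooth_on S (\<Omega>m a)"
  shows "smooth_on S (killing_rhs E \<rho> \<Omega>m a)"
proof -
  have "smooth_on S (\<lambda>x. rho_mat \<rho> x)"
    unfolding rho_mat_def by (intro smooth_on_vec_lambda smooth_on_vec_nth S \<rho>)
  then have "smooth_on S (\<lambda>x. lie_deriv (\<rho> a) E x - transpose (transpose (E x) ** rho_mat \<rho> x ** \<Omega>m a x))"
    by (intro smooth_on_diff smooth_on_lie_deriv smooth_on_bounded_linear[OF _ bounded_linear_transpose]
        smooth_on_bounded_bilinear[OF _ bounded_bilinear_matrix_mul] S E \<rho> \<Omega>)
  then show ?thesis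
    unfolding killing_rhs_def .
qed

lemma smooth_on_solution_formula:
  assumes S: "open S" and E: "smooth_on S E" and \<rho>: "\<And>b. smooth_on S (\<rho> b)" and \<Omega>: "smooth_on S (\<Omega>m a)"
    and X: "smooth_on S (X a)" and P: "smooth_on S (\<lambda>x. pinv (E x ** rho_mat \<rho> x))"
  shows "smooth_on S (solution_formula E \<rho> \<Omega>m X a)"
proof -
  have "smooth_on S (\<lambda>x. rho_mat \<rho> x)"
    unfolding rho_mat_def by (intro smooth_on_vec_lambda smooth_on_vec_nth S \<rho>)
  moreover have "smooth_on S (\<lambda>x. killing_rhs E \<rho> \<Omega>m a x)"
    by (rule smooth_on_killing_rhs) (use assms in auto)
  ultimately have "smooth_on S (\<lambda>x. pinv (E x ** rho_mat \<rho> x) ** killing_rhs E \<rho> \<Omega>m a x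
      + (mat 1 - pinv (E x ** rho_mat \<rho> x) ** (E x ** rho_mat \<rho> x)) ** X a x)"
    by (intro smooth_on_add smooth_on_diff smooth_on_const
        smooth_on_bounded_bilinear[OF _ bounded_bilinear_matrix_mul] S E X P)
  then show ?thesis
    unfolding solution_formula_def .
qed

section \<open>The minimal solution under changes of charts\<close>

lemma transition_in_overlap:
  assumes "inj_on (snd c) (fst c)" "x \<in> overlap c d"
  shows "transition c d x \<in> overlap d c"
  using assms by (auto simp: overlap_def transition_def chart_inv_def)

lemma transition_inverse:
  assumes "inj_on (snd c) (fst c)" "inj_on (snd d) (fst d)" "x \<in> overlap c d"
  shows "transition d c (transition c d x) = x"
  using assms by (auto simp: overlap_def transition_def chart_inv_def)

lemma overlap_subset_coords: "overlap c d \<subseteq> coords c"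
  by (auto simp: overlap_def coords_def)

context
  fixes A :: "('m::{t2_space,second_countable_topology}, 'n::finite) chart set"
  assumes atlas: "smooth_atlas A"
begin

lemma open_coords: "c \<in> A \<Longrightarrow> open (coords c)"
  using atlas by (auto simp: smooth_atlas_def)

lemma inj_on_chart:
  assumes "c \<in> A"
  shows "inj_on (snd c) (fst c)"
proof -
  have "homeomorphism (fst c) (coords c) (snd c) (chart_inv c)"
    using atlas assms by (auto simp: smooth_atlas_def)
  then show ?thesis
    by (metis homeomorphism_apply1 inj_on_inverseI)
qed

lemma open_overlap:
  assumes "c \<in> A" "d \<in> A"
  shows "open (overlap c d)"
proof -
  have c: "homeomorphism (fst c) (coords c) (snd c) (chart_inv c)" "open (coords c)" "open (fst d)"
    using atlas assms by (auto simp: smooth_atlas_def)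
  have "openin (top_of_set (fst c)) (fst c \<inter> fst d)"
    using c(3) by (rule openin_open_Int)
  then have "openin (top_of_set (coords c)) (overlap c d)"
    unfolding overlap_def by (rule homeomorphism_imp_open_map[OF c(1)])
  then show ?thesis
    using c(2) openin_open_trans by blast
qed

lemma smooth_on_transition: "c \<in> A \<Longrightarrow> d \<in> A \<Longrightarrow> smooth_on (overlap c d) (transition c d)"
  using atlas by (auto simp: smooth_atlas_def)

lemma jac_inverse:
  assumes c: "c \<in> A" and d: "d \<in> A" and x: "x \<in> overlap c d"
  shows "jac d c (transition c d x) ** jac c d x = mat 1"
proof -
  let ?y = "transition c d x"
  have "((\<lambda>z. transition d c (transition c d z)) has_derivative
      (\<lambda>h. jac d c ?y *v (jac c d x *v h))) (at x)"
  proof (rule has_derivative_compose[of "transition c d" "\<lambda>h. jac c d x *v h" x UNIV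
        "transition d c" "\<lambda>h. jac d c ?y *v h"])
    show "(transition c d has_derivative (*v) (jac c d x)) (at x)"
      unfolding jac_def jacobian_works[symmetric]
      by (rule smooth_on_differentiable[OF smooth_on_transition[OF c d] x])
    show "(transition d c has_derivative (*v) (jac d c ?y)) (at ?y)"
      unfolding jac_def jacobian_works[symmetric]
      by (rule smooth_on_differentiable[OF smooth_on_transition[OF d c]
            transition_in_overlap[OF inj_on_chart[OF c] x]])
  qed
  moreover have "((\<lambda>z. transition d c (transition c d z)) has_derivative (\<lambda>h. h)) (at x)"
    by (rule has_derivative_transform_within_open[OF has_derivative_ident open_overlap[OF c d] x])
      (simp add: transition_inverse[OF inj_on_chart[OF c] inj_on_chart[OF d]])
  ultimately have "(\<lambda>h. jac d c ?y *v (jac c d x *v h)) = (\<lambda>h. h)"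
    by (rule has_derivative_unique)
  then show ?thesis
    by (simp add: matrix_eq fun_eq_iff flip: matrix_vector_mul_assoc)
qed

context
  fixes E :: "('m, 'n, real^'n^'n) field"
    and \<rho> :: "'k::finite \<Rightarrow> ('m, 'n, real^'n) field"
    and \<Omega>m :: "'k \<Rightarrow> ('m, 'n, real^'n^'k) field"
    and c d :: "('m, 'n) chart" and x :: "real^'n"
  assumes E: "cov2_tensor_field A E"
    and \<rho>: "\<And>a. vector_field A (\<rho> a)"
    and c: "c \<in> A" and d: "d \<in> A" and x: "x \<in> overlap c d"
begin

lemma rho_mat_transition:
  "rho_mat (in_chart \<rho> d) (transition c d x) = jac c d x ** rho_mat (in_chart \<rho> c) x"
proof -
  have "\<rho> a d (transition c d x) = jac c d x *v \<rho> a c x" for a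
    using \<rho> c d x by (simp add: vector_field_def)
  then show ?thesis
    by (simp add: vec_eq_iff rho_mat_def in_chart_def matrix_matrix_mult_def matrix_vector_mult_def)
qed

text \<open>
  Only the row index of \<open>E\<rho>\<close> is a coordinate index, the column index refers to the frame of \<open>Q\<close>. Hence
  \<open>E\<rho>\<close> is multiplied by an invertible matrix from the left only.
\<close>

lemma E_rho_transition:
  "E c x ** rho_mat (in_chart \<rho> c) x =
   transpose (jac c d x) ** (E d (transition c d x) ** rho_mat (in_chart \<rho> d) (transition c d x))"
proof -
  have "E c x = transpose (jac c d x) ** E d (transition c d x) ** jac c d x"
    using E c d x by (simp add: cov2_tensor_field_def)
  then show ?thesis
    by (simp add: rho_mat_transition matrix_mul_assoc)
qed

lemma killing_rhs_transition:
  assumes \<Omega>m: "TQ_section A (\<Omega>m a)"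
  shows "killing_rhs (E c) (in_chart \<rho> c) (in_chart \<Omega>m c) a x =
    transpose (jac c d x) **
    killing_rhs (E d) (in_chart \<rho> d) (in_chart \<Omega>m d) a (transition c d x) ** jac c d x"
proof -
  let ?y = "transition c d x" and ?J = "jac c d x"
  have xc: "x \<in> coords c" and yd: "?y \<in> coords d"
    using x overlap_subset_coords transition_in_overlap[OF inj_on_chart[OF c] x] by blast+
  have Ec: "smooth_on (coords c') (E c')" and \<rho>c: "smooth_on (coords c') (\<rho> a c')" if "c' \<in> A" for c'
    using E \<rho>[of a] that by (auto simp: cov2_tensor_field_def vector_field_def smooth_field_def)
  have lie: "lie_deriv (\<rho> a c) (E c) x = transpose ?J ** lie_deriv (\<rho> a d) (E d) ?y ** ?J"
    unfolding jac_def
  proof (rule lie_deriv_pullback[OF open_overlap[OF c d] x smooth_on_transition[OF c d]])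
    show "\<rho> a c differentiable (at x)" "\<rho> a d differentiable (at ?y)" "E d differentiable (at ?y)"
      by (rule smooth_on_differentiable; fact \<rho>c[OF c] \<rho>c[OF d] Ec[OF d] xc yd)+
    show "\<rho> a d (transition c d y) = jacobian (transition c d) (at y) *v \<rho> a c y"
      and "E c y = transpose (jacobian (transition c d) (at y)) ** E d (transition c d y)
        ** jacobian (transition c d) (at y)" if "y \<in> overlap c d" for y
      using E \<rho>[of a] c d that by (auto simp: cov2_tensor_field_def vector_field_def jac_def)
  qed
  have \<Omega>: "\<Omega>m a c x = \<Omega>m a d ?y ** ?J"
    using \<Omega>m c d x by (simp add: TQ_section_def)
  have tr: "transpose (transpose M ** R ** N) = transpose N ** transpose R ** M"
    for M :: "real^'n^'n" and R :: "real^'k^'n" and N :: "real^'n^'k"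
    by (simp add: matrix_transpose_mul matrix_mul_assoc)
  have Etr: "E c x = transpose ?J ** E d ?y ** ?J"
    using E c d x by (simp add: cov2_tensor_field_def)
  have comp: "in_chart \<rho> c' a = \<rho> a c'" "in_chart \<Omega>m c' a = \<Omega>m a c'" for c'
    by (simp_all add: in_chart_def)
  show ?thesis
    unfolding killing_rhs_def tr
    by (simp add: comp lie \<Omega> Etr rho_mat_transition
        matrix_transpose_mul matrix_mul_diff_left matrix_mul_diff_right matrix_mul_assoc)
qed

end

text \<open>
  The solutions \<open>(E\<rho>)\<^sup>+ F\<close> that the charts provide separately agree on overlaps. The inverse depends on
  the Euclidean inner products of both the coordinate space and the fibre of \<open>Q\<close>, but on solvable
  right-hand sides only the one of the fibre matters, and this one is given by the frame.
\<close>

lemma TQ_section_minimal_solution: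
  assumes E: "cov2_tensor_field A E" and \<rho>: "\<And>a. vector_field A (\<rho> a)"
    and \<Omega>m: "TQ_section A (\<Omega>m a)" and solv: "solvability A E \<rho> \<Omega>m"
  shows "TQ_section A (\<lambda>c. solution_formula (E c) (in_chart \<rho> c) (in_chart \<Omega>m c) (\<lambda>_ _. 0) a)"
  unfolding TQ_section_def
proof (intro ballI)
  fix c d x assume c: "c \<in> A" and d: "d \<in> A" and x: "x \<in> overlap c d"
  let ?y = "transition c d x" and ?J = "jac c d x"
  let ?B = "E d ?y ** rho_mat (in_chart \<rho> d) ?y"
  let ?F = "killing_rhs (E d) (in_chart \<rho> d) (in_chart \<Omega>m d) a ?y"
  have "?y \<in> coords d"
    using overlap_subset_coords transition_in_overlap[OF inj_on_chart[OF c] x] by blast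
  then have F: "?F = ?B ** pinv ?B ** ?F"
    using solv d unfolding solvability_def solvability_on_def by blast
  have "?J ** jac d c ?y = mat 1"
    using jac_inverse[OF c d x] matrix_left_right_inverse by blast
  then have "transpose (jac d c ?y) ** transpose ?J = mat 1"
    by (metis matrix_transpose_mul transpose_mat)
  from pinv_solution_covariant[OF this F, of ?J]
  show "solution_formula (E c) (in_chart \<rho> c) (in_chart \<Omega>m c) (\<lambda>_ _. 0) a x =
      solution_formula (E d) (in_chart \<rho> d) (in_chart \<Omega>m d) (\<lambda>_ _. 0) a ?y ** ?J"
    by (simp add: solution_formula_def bounded_bilinear.zero_right[OF bounded_bilinear_matrix_mul]
        E_rho_transition[OF E \<rho> c d x] killing_rhs_transition[where \<rho>=\<rho> and \<Omega>m=\<Omega>m, OF E \<rho> c d x \<Omega>m])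
qed

end

theorem theorem4p1:
  fixes A :: "('m::{t2_space,second_countable_topology}, 'n::finite) chart set"
    and E :: "('m, 'n, real^'n^'n) field"
    and \<rho> :: "'k::finite \<Rightarrow> ('m, 'n, real^'n) field"
    and C :: "'k \<Rightarrow> 'k \<Rightarrow> 'k \<Rightarrow> 'm \<Rightarrow> real"
    and br :: "('m \<Rightarrow> real^'k) \<Rightarrow> ('m \<Rightarrow> real^'k) \<Rightarrow> ('m \<Rightarrow> real^'k)"
  assumes "smooth_atlas A"
    and "cov2_tensor_field A E"
    and "\<And>a. vector_field A (\<rho> a)"
    and "involutive_with A \<rho> C"
    and "lie_algebroid A \<rho> br"
    and "\<And>a b p. br (frame a) (frame b) p = (\<Sum>c\<in>UNIV. C c a b p *\<^sub>R frame c p)"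
  shows
    \<comment> \<open>solvability in smooth sections\<close>
    "(smooth_pinv A E \<rho> \<longrightarrow>
       ((\<exists>\<Omega>p \<Omega>m. (\<forall>a. smooth_TQ_section A (\<Omega>p a)) \<and> (\<forall>a. smooth_TQ_section A (\<Omega>m a)) \<and>
          gen_killing A E \<rho> \<Omega>p \<Omega>m)
        \<longleftrightarrow>
        (\<exists>\<Omega>m. (\<forall>a. smooth_TQ_section A (\<Omega>m a)) \<and> solvability A E \<rho> \<Omega>m)))
     \<and>
     \<comment> \<open>the same for \<open>E\<rho>\<close> of arbitrary rank, with \<open>\<Omega>\<^sup>+\<close> not necessarily smooth\<close>
     ((\<exists>\<Omega>p \<Omega>m. (\<forall>a. TQ_section A (\<Omega>p a)) \<and> (\<forall>a. smooth_TQ_section A (\<Omega>m a)) \<and>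
          gen_killing A E \<rho> \<Omega>p \<Omega>m)
        \<longleftrightarrow>
        (\<exists>\<Omega>m. (\<forall>a. smooth_TQ_section A (\<Omega>m a)) \<and> solvability A E \<rho> \<Omega>m))
     \<and>
     \<comment> \<open>the formula gives solutions, in every chart\<close>
     (\<forall>\<Omega>m. (\<forall>a. smooth_TQ_section A (\<Omega>m a)) \<and> solvability A E \<rho> \<Omega>m \<longrightarrow>
        (\<forall>c\<in>A. \<forall>X.
           gen_killing_on (coords c) (E c) (in_chart \<rho> c)
             (solution_formula (E c) (in_chart \<rho> c) (in_chart \<Omega>m c) X) (in_chart \<Omega>m c) \<and>
           (smooth_pinv A E \<rho> \<and> (\<forall>a. smooth_on (coords c) (X a)) \<longrightarrow>
              (\<forall>a. smooth_on (coords c)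
                (solution_formula (E c) (in_chart \<rho> c) (in_chart \<Omega>m c) X a)))))
     \<and>
     \<comment> \<open>every solution is of this form\<close>
     (\<forall>\<Omega>p \<Omega>m. (\<forall>a. TQ_section A (\<Omega>p a)) \<and> (\<forall>a. smooth_TQ_section A (\<Omega>m a)) \<and>
          gen_killing A E \<rho> \<Omega>p \<Omega>m \<longrightarrow>
        solvability A E \<rho> \<Omega>m \<and>
        (\<forall>c\<in>A. \<exists>X.
           ((\<forall>a. smooth_TQ_section A (\<Omega>p a)) \<longrightarrow> (\<forall>a. smooth_on (coords c) (X a))) \<and>
           (\<forall>a. \<forall>x\<in>coords c.
              \<Omega>p a c x = solution_formula (E c) (in_chart \<rho> c) (in_chart \<Omega>m c) X a x)))"
proof -
  note atlas = assms(1) and E = assms(2) and \<rho> = assms(3)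
  have necessary: "solvability A E \<rho> \<Omega>m" if "gen_killing A E \<rho> \<Omega>p \<Omega>m" for \<Omega>p \<Omega>m
    using that gen_killing_on_imp_solvability_on unfolding gen_killing_def solvability_def by blast
  have smooth: "smooth_on (coords c) (solution_formula (E c) (in_chart \<rho> c) (in_chart \<Omega>m c) X a)"
    if "\<forall>a. smooth_TQ_section A (\<Omega>m a)" "smooth_pinv A E \<rho>" "c \<in> A" "smooth_on (coords c) (X a)"
    for \<Omega>m c X a
    by (rule smooth_on_solution_formula)
      (use that E \<rho> open_coords[OF atlas] in \<open>auto simp: cov2_tensor_field_def vector_field_def
        smooth_field_def smooth_TQ_section_def smooth_pinv_def in_chart_def\<close>)
  \<comment> \<open>among the solutions of the formula, the parameter \<open>0\<close> gives one that is globally defined;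
    parameters chosen chart by chart need not fit together\<close>
  define \<Omega>0 where
    "\<Omega>0 \<Omega>m a c = solution_formula (E c) (in_chart \<rho> c) (in_chart \<Omega>m c) (\<lambda>_ _. 0) a" for \<Omega>m a c
  have minimal: "gen_killing A E \<rho> (\<Omega>0 \<Omega>m) \<Omega>m" "TQ_section A (\<Omega>0 \<Omega>m a)"
      "smooth_pinv A E \<rho> \<Longrightarrow> smooth_TQ_section A (\<Omega>0 \<Omega>m a)"
    if \<Omega>m: "\<forall>a. smooth_TQ_section A (\<Omega>m a)" "solvability A E \<rho> \<Omega>m" for \<Omega>m a
  proof -
    have \<Omega>0: "in_chart (\<Omega>0 \<Omega>m) c = solution_formula (E c) (in_chart \<rho> c) (in_chart \<Omega>m c) (\<lambda>_ _. 0)" for c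
      by (rule ext) (simp add: in_chart_def \<Omega>0_def)
    show "gen_killing A E \<rho> (\<Omega>0 \<Omega>m) \<Omega>m"
      unfolding gen_killing_def \<Omega>0
      using \<Omega>m(2) gen_killing_on_solution_formula unfolding solvability_def by blast
    show sec: "TQ_section A (\<Omega>0 \<Omega>m a)"
      unfolding \<Omega>0_def using \<Omega>m
      by (intro TQ_section_minimal_solution[OF atlas E \<rho>]) (auto simp: smooth_TQ_section_def)
    show "smooth_TQ_section A (\<Omega>0 \<Omega>m a)" if "smooth_pinv A E \<rho>"
      using sec unfolding smooth_TQ_section_def smooth_field_def \<Omega>0_def
      by (intro conjI ballI smooth[OF \<Omega>m(1) that] smooth_on_const)
  qed
  have complete: "\<exists>X. ((\<forall>a. smooth_TQ_section A (\<Omega>p a)) \<longrightarrow> (\<forall>a. smooth_on (coords c) (X a))) \<and>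
      (\<forall>a. \<forall>x\<in>coords c. \<Omega>p a c x = solution_formula (E c) (in_chart \<rho> c) (in_chart \<Omega>m c) X a x)"
    if "gen_killing A E \<rho> \<Omega>p \<Omega>m" "c \<in> A" for \<Omega>p \<Omega>m c
  proof (intro exI[of _ "in_chart \<Omega>p c"] conjI impI allI ballI)
    show "smooth_on (coords c) (in_chart \<Omega>p c a)" if "\<forall>a. smooth_TQ_section A (\<Omega>p a)" for a
      using that \<open>c \<in> A\<close> by (auto simp: in_chart_def smooth_TQ_section_def smooth_field_def)
    show "\<Omega>p a c x = solution_formula (E c) (in_chart \<rho> c) (in_chart \<Omega>m c) (in_chart \<Omega>p c) a x"
      if "x \<in> coords c" for a x
      using \<open>gen_killing A E \<rho> \<Omega>p \<Omega>m\<close> \<open>c \<in> A\<close> that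
      by (subst solution_formula_self[of "coords c"]) (auto simp: gen_killing_def in_chart_def)
  qed
  show ?thesis
    apply (intro conjI)
    subgoal using necessary minimal(1,3) by blast
    subgoal using necessary minimal(1,2) by blast
    subgoal using smooth gen_killing_on_solution_formula unfolding solvability_def by blast
    subgoal using necessary complete by blast
    done
qed

end
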